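(* Let $U = \langle 1 \mapsto J(1,2,5),\ 2 \mapsto S(2),\ 3 \mapsto S(3),\ 4 \mapsto J(1,1,1),\ 5 \mapsto T(3,1) \rangle$ and let $\sigma = (1 \mapsto \sigma_1,\ 2 \mapsto \sigma_2,\ 3 \mapsto \sigma_3, \ldots)$ be a parameter configuration. Then the implementation of the partial minus function is certified by the following properties: (1) (Divergence) $\sigma_1 < \sigma_2 \Rightarrow cp_{\infty}(U,\sigma,1)$; (2) (Convergence) $\sigma_1 \geq \sigma_2 \Rightarrow cp_+(U, \sigma, 1, ( 1 \mapsto \sigma_1 - \sigma_2 + \sigma_3,\ 2 \mapsto \sigma_1,\ 3 \mapsto \sigma_1 - \sigma_2 + \sigma_3, \ldots) )$.
   Context: Setting: the Unlimited Register Machine (URM) formalized in the Calculus of (Co)Inductive Constructions, with infinite (stream) configurations $(\iota \mapsto r_\iota)^{\iota \in [1..\infty)}$. Instructions: $Z(i)$ ($0 \to R_i$), $S(i)$ ($r_i+1 \to R_i$), $T(i,j)$ ($r_i \to R_j$), $J(i,j,k)$ (if $r_i = r_j$ proceed from the $k$th instruction, else from the next). For a program $U = \langle \iota \mapsto I_\iota\rangle^{\iota \in [1..n]}$ and $h \in [1..n]$: $cp_+(U,\sigma,h,\tau)$ (computation from the $h$th instruction stops, turning $\sigma$ into $\tau$) is defined inductively by: if $I_h = J(i,j,k)$: ($h = n$, $r_i \neq r_j$) gives $cp_+(U,\sigma,h,\sigma)$; ($h<n$, $r_i \neq r_j$, $cp_+(U,\sigma,h+1,\tau)$) gives $cp_+(U,\sigma,h,\tau)$;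 ($k=0$, $r_i = r_j$) gives $cp_+(U,\sigma,h,\sigma)$; ($k \neq 0$, $r_i = r_j$, $cp_+(U,\sigma,k,\tau)$) gives $cp_+(U,\sigma,h,\tau)$. If $I_h$ is $Z(i)$, $S(i)$ or $T(i,j)$, with $f(\sigma)$ respectively setting $R_i$ to $0$, incrementing $R_i$, copying $r_i$ into $R_j$: ($h=n$) gives $cp_+(U,\sigma,h,f(\sigma))$; ($h<n$, $cp_+(U,f(\sigma),h+1,\tau)$) gives $cp_+(U,\sigma,h,\tau)$. $cp_{\infty}(U,\sigma,h)$ (computation from the $h$th instruction diverges) is defined coinductively by: for $I_h = J(i,j,k)$: ($h<n$, $r_i \neq r_j$, $cp_{\infty}(U,\sigma,h+1)$) gives $cp_{\infty}(U,\sigma,h)$; ($k\neq 0$, $r_i = r_j$, $cp_{\infty}(U,\sigma,k)$) gives $cp_{\infty}(U,\sigma,h)$; for $Z$, $S$, $T$: ($h<n$, $cp_{\infty}(U,f(\sigma),h+1)$) gives $cp_{\infty}(U,\sigma,h)$. The program $U$ implements partial subtraction $sub(m,n) = m-n$ if $m \geq n$, undefined if $m<n$, by incrementing $R_2$ and $R_3$ in parallel until $r_2 = r_1$. *)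

theory Defs
  imports Main "HOL-Library.Stream"
begin

datatype instr =
    Z nat
  | S nat
  | T nat nat
  | J nat nat nat

type_synonym program = "instr list"

type_synonym config = "nat stream"

text \<open>Registers and instructions are numbered from 1, whereas \<^const>\<open>snth\<close> and
  \<^const>\<open>nth\<close> count from 0; hence the shift by one. Register 0 does not exist, and programs
  are not supposed to mention it.\<close>

definition reg :: "config \<Rightarrow> nat \<Rightarrow> nat" where
  "reg \<sigma> i = \<sigma> !! (i - 1)"

definition set_reg :: "config \<Rightarrow> nat \<Rightarrow> nat \<Rightarrow> config" where
  "set_reg \<sigma> i v = smap ((snth \<sigma>)(i - 1 := v)) nats"

definition instr_at :: "program \<Rightarrow> nat \<Rightarrow> instr \<Rightarrow> bool" where
  "instr_at U h I \<longleftrightarrow> 1 \<le> h \<and> h \<le> length U \<and> U ! (h - 1) = I"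

text \<open>The transformation of the configuration performed by a non-jump instruction.\<close>

fun effect :: "instr \<Rightarrow> (config \<Rightarrow> config) option" where
  "effect (Z i) = Some (\<lambda>\<sigma>. set_reg \<sigma> i 0)"
| "effect (S i) = Some (\<lambda>\<sigma>. set_reg \<sigma> i (reg \<sigma> i + 1))"
| "effect (T i j) = Some (\<lambda>\<sigma>. set_reg \<sigma> j (reg \<sigma> i))"
| "effect (J i j k) = None"

inductive cp_plus :: "program \<Rightarrow> config \<Rightarrow> nat \<Rightarrow> config \<Rightarrow> bool" for U where
  jump_neq_end:
    "instr_at U h (J i j k) \<Longrightarrow> h = length U \<Longrightarrow> reg \<sigma> i \<noteq> reg \<sigma> j \<Longrightarrow> cp_plus U \<sigma> h \<sigma>"
| jump_neq_next:
    "instr_at U h (J i j k) \<Longrightarrow> h < length U \<Longrightarrow> reg \<sigma> i \<noteq> reg \<sigma> j \<Longrightarrow>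
      cp_plus U \<sigma> (h + 1) \<tau> \<Longrightarrow> cp_plus U \<sigma> h \<tau>"
| jump_eq_end:
    "instr_at U h (J i j k) \<Longrightarrow> k = 0 \<Longrightarrow> reg \<sigma> i = reg \<sigma> j \<Longrightarrow> cp_plus U \<sigma> h \<sigma>"
| jump_eq_goto:
    "instr_at U h (J i j k) \<Longrightarrow> k \<noteq> 0 \<Longrightarrow> reg \<sigma> i = reg \<sigma> j \<Longrightarrow>
      cp_plus U \<sigma> k \<tau> \<Longrightarrow> cp_plus U \<sigma> h \<tau>"
| effect_end:
    "instr_at U h I \<Longrightarrow> effect I = Some f \<Longrightarrow> h = length U \<Longrightarrow> cp_plus U \<sigma> h (f \<sigma>)"
| effect_next:
    "instr_at U h I \<Longrightarrow> effect I = Some f \<Longrightarrow> h < length U \<Longrightarrow>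
      cp_plus U (f \<sigma>) (h + 1) \<tau> \<Longrightarrow> cp_plus U \<sigma> h \<tau>"

coinductive cp_inf :: "program \<Rightarrow> config \<Rightarrow> nat \<Rightarrow> bool" for U where
  jump_neq_next:
    "instr_at U h (J i j k) \<Longrightarrow> h < length U \<Longrightarrow> reg \<sigma> i \<noteq> reg \<sigma> j \<Longrightarrow>
      cp_inf U \<sigma> (h + 1) \<Longrightarrow> cp_inf U \<sigma> h"
| jump_eq_goto:
    "instr_at U h (J i j k) \<Longrightarrow> k \<noteq> 0 \<Longrightarrow> reg \<sigma> i = reg \<sigma> j \<Longrightarrow>
      cp_inf U \<sigma> k \<Longrightarrow> cp_inf U \<sigma> h"
| effect_next:
    "instr_at U h I \<Longrightarrow> effect I = Some f \<Longrightarrow> h < length U \<Longrightarrow>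
      cp_inf U (f \<sigma>) (h + 1) \<Longrightarrow> cp_inf U \<sigma> h"

end

theory Submission
  imports Defs
begin

text \<open>Every round of the loop 1--4 increments registers 2 and 3 and leaves register 1 unchanged.
  Strict excess of register 2 over register 1 is therefore a loop invariant, so the exit test at 1
  never succeeds, which gives divergence by coinduction; otherwise the excess of register 1 over
  register 2 drops by one in each round, which gives convergence by induction on it.\<close>

text \<open>The second equation starts at index 2 because registers count from 1:
  \<open>i - 1\<close> sends both 0 and 1 to the head. Numerals reach these patterns through
  \<open>numeral_eq_Suc\<close>.\<close>

lemma reg_SCons [simp]:
  "reg (a ## s) (Suc 0) = a"
  "reg (a ## s) (Suc (Suc i)) = reg s (Suc i)"
  by (simp_all add: reg_def)

lemma snth_set_reg: "set_reg \<sigma> i v !! n = (if n = i - 1 then v else \<sigma> !! n)"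
  by (simp add: set_reg_def)

lemma stream_eqI_snth:
  assumes "\<And>n. s !! n = t !! n"
  shows "s = t"
proof -
  from assms have "snth s = snth t"
    by (rule ext)
  then show ?thesis
    \<comment> \<open>A stream is recovered from its index function by mapping it over
      \<open>nats\<close>.\<close>
    by (metis stream_smap_nats)
qed

text \<open>Since \<open>set_reg\<close> is built from \<open>nats\<close>, comparing entries is the
  way back to constructor form. With these rules simp executes instructions on explicit
  configurations.\<close>

lemma set_reg_SCons [simp]:
  "set_reg (a ## s) (Suc 0) v = v ## s"
  "set_reg (a ## s) (Suc (Suc i)) v = a ## set_reg s (Suc i) v"
proof -
  show "set_reg (a ## s) (Suc 0) v = v ## s"
  proof (rule stream_eqI_snth)
    fix n show "set_reg (a ## s) (Suc 0) v !! n = (v ## s) !! n"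
      unfolding snth_set_reg by (cases n) simp_all
  qed
  show "set_reg (a ## s) (Suc (Suc i)) v = a ## set_reg s (Suc i) v"
  proof (rule stream_eqI_snth)
    fix n show "set_reg (a ## s) (Suc (Suc i)) v !! n = (a ## set_reg s (Suc i) v) !! n"
      unfolding snth_set_reg by (cases n) (simp_all add: snth_set_reg)
  qed
qed

definition sub_program :: program where
  "sub_program = [J 1 2 5, S 2, S 3, J 1 1 1, T 3 1]"

lemma instr_at_sub_program:
  "instr_at sub_program 1 (J 1 2 5)"
  "instr_at sub_program 2 (S 2)"
  "instr_at sub_program 3 (S 3)"
  "instr_at sub_program 4 (J 1 1 1)"
  "instr_at sub_program 5 (T 3 1)"
  by (simp_all add: instr_at_def sub_program_def)

lemma length_sub_program [simp]: "length sub_program = 5"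
  by (simp add: sub_program_def)

lemma sub_program_diverges:
  assumes "a < b"
  shows "cp_inf sub_program (a ## b ## c ## \<rho>) 1"
proof -
  \<comment> \<open>Each coinductive rule executes a single instruction, so the invariant must also
    hold at the intermediate points 2, 3 and 4. The value of register 3 is left free because it
    grows.\<close>
  define inv where
    "inv \<sigma> h \<longleftrightarrow> h \<in> {1, 2, 3, 4} \<and> (\<exists>a b c. a < b \<and> \<sigma> = a ## b ## c ## \<rho>)"
    for \<sigma> :: config and h :: nat
  from assms have "inv (a ## b ## c ## \<rho>) 1"
    by (auto simp: inv_def)
  then show ?thesis
  proof (coinduct rule: cp_inf.coinduct)
    case (cp_inf \<sigma> h)
    then obtain a b c where less: "a < b" and \<sigma>: "\<sigma> = a ## b ## c ## \<rho>"
      and h: "h \<in> {1, 2, 3, 4}"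
      by (auto simp: inv_def)
    then have bound: "h < length sub_program"
      by auto
    from h consider "h = 1" | "h = 2" | "h = 3" | "h = 4"
      by blast
    then show ?case
    proof cases
      case 1
      then have "instr_at sub_program h (J 1 2 5)"
        using instr_at_sub_program(1) by simp
      moreover have "reg \<sigma> 1 \<noteq> reg \<sigma> 2"
        using less by (simp add: \<sigma> numeral_eq_Suc)
      moreover have "inv \<sigma> (h + 1)"
        using less by (auto simp: inv_def 1 \<sigma>)
      ultimately show ?thesis
        using bound by blast
    next
      case 2
      then have "instr_at sub_program h (S 2)"
        using instr_at_sub_program(2) by simp
      moreover have "inv (set_reg \<sigma> 2 (reg \<sigma> 2 + 1)) (h + 1)"
        using less by (auto simp: inv_def 2 \<sigma> numeral_eq_Suc)
      ultimately show ?thesis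
        using bound effect.simps(2) by blast
    next
      case 3
      then have "instr_at sub_program h (S 3)"
        using instr_at_sub_program(3) by simp
      moreover have "inv (set_reg \<sigma> 3 (reg \<sigma> 3 + 1)) (h + 1)"
        using less by (auto simp: inv_def 3 \<sigma> numeral_eq_Suc)
      ultimately show ?thesis
        using bound effect.simps(2) by blast
    next
      case 4
      then have "instr_at sub_program h (J 1 1 1)"
        using instr_at_sub_program(4) by simp
      moreover have "inv \<sigma> 1"
        using less by (auto simp: inv_def \<sigma>)
      \<comment> \<open>\<open>J 1 1 1\<close> compares a register with itself, so it always jumps;
        \<open>one_neq_zero\<close> certifies that target 1 is not the halting target 0.\<close>
      ultimately show ?thesis
        using one_neq_zero by blast
    qed
  qed
qed

lemma sub_program_loop_exit:
  "cp_plus sub_program (a ## a ## c ## \<rho>) 1 (c ## a ## c ## \<rho>)"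
proof -
  have "cp_plus sub_program (a ## a ## c ## \<rho>) 5 (c ## a ## c ## \<rho>)"
    using cp_plus.effect_end [OF instr_at_sub_program(5) effect.simps(3), of "a ## a ## c ## \<rho>"]
    by (simp add: numeral_eq_Suc)
  then show ?thesis
    by (intro cp_plus.jump_eq_goto [OF instr_at_sub_program(1)]) (simp_all add: numeral_eq_Suc)
qed

text \<open>The rules of \<open>cp_plus\<close> derive a computation from its continuation, so the
  round is assembled backwards, from instruction 4 to instruction 1.\<close>

lemma sub_program_loop_step:
  assumes "a \<noteq> b" and "cp_plus sub_program (a ## Suc b ## Suc c ## \<rho>) 1 \<tau>"
  shows "cp_plus sub_program (a ## b ## c ## \<rho>) 1 \<tau>"
proof -
  have "cp_plus sub_program (a ## Suc b ## Suc c ## \<rho>) 4 \<tau>"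
    using assms(2) by (intro cp_plus.jump_eq_goto [OF instr_at_sub_program(4)]) simp_all
  then have "cp_plus sub_program (a ## Suc b ## c ## \<rho>) 3 \<tau>"
    by (intro cp_plus.effect_next [OF instr_at_sub_program(3) effect.simps(2)])
      (simp_all add: numeral_eq_Suc)
  then have "cp_plus sub_program (a ## b ## c ## \<rho>) 2 \<tau>"
    by (intro cp_plus.effect_next [OF instr_at_sub_program(2) effect.simps(2)])
      (simp_all add: numeral_eq_Suc)
  then show ?thesis
    using assms(1) by (intro cp_plus.jump_neq_next [OF instr_at_sub_program(1)])
      (simp_all add: numeral_eq_Suc)
qed

text \<open>Here \<open>n\<close> counts the remaining rounds; writing register 1 as
  \<open>b + n\<close> avoids truncated subtraction. A round trades one unit of \<open>n\<close> for
  one in \<open>b\<close> and one in \<open>c\<close>, so \<open>b + n\<close> and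
  \<open>n + c\<close> keep their values; \<open>b\<close> and \<open>c\<close> must vary in the
  induction.\<close>

lemma sub_program_converges:
  "cp_plus sub_program ((b + n) ## b ## c ## \<rho>) 1 ((n + c) ## (b + n) ## (n + c) ## \<rho>)"
proof (induction n arbitrary: b c)
  case 0
  then show ?case
    using sub_program_loop_exit by simp
next
  case (Suc n)
  show ?case
    using Suc.IH [of "Suc b" "Suc c"] by - (rule sub_program_loop_step, simp_all)
qed

theorem mainTheorem2:
  fixes U :: program and \<sigma> \<rho> :: config and \<sigma>1 \<sigma>2 \<sigma>3 :: nat
  assumes U: "U = [J 1 2 5, S 2, S 3, J 1 1 1, T 3 1]"
    and \<sigma>: "\<sigma> = \<sigma>1 ## \<sigma>2 ## \<sigma>3 ## \<rho>"
  shows "(\<sigma>1 < \<sigma>2 \<longrightarrow> cp_inf U \<sigma> 1) \<and>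
    (\<sigma>1 \<ge> \<sigma>2 \<longrightarrow>
      cp_plus U \<sigma> 1 ((\<sigma>1 - \<sigma>2 + \<sigma>3) ## \<sigma>1 ## (\<sigma>1 - \<sigma>2 + \<sigma>3) ## \<rho>))"
proof (intro conjI impI)
  assume "\<sigma>1 < \<sigma>2"
  then show "cp_inf U \<sigma> 1"
    unfolding U \<sigma> sub_program_def [symmetric] by (rule sub_program_diverges)
next
  assume "\<sigma>1 \<ge> \<sigma>2"
  then show "cp_plus U \<sigma> 1 ((\<sigma>1 - \<sigma>2 + \<sigma>3) ## \<sigma>1 ## (\<sigma>1 - \<sigma>2 + \<sigma>3) ## \<rho>)"
    unfolding U \<sigma> sub_program_def [symmetric]
    \<comment> \<open>The assumption turns \<open>\<sigma>2 + (\<sigma>1 - \<sigma>2)\<close> into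
      \<open>\<sigma>1\<close>.\<close>
    using sub_program_converges [of \<sigma>2 "\<sigma>1 - \<sigma>2" \<sigma>3 \<rho>] by simp
qed

end
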